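(* There is no co-circular four-body central configuration with vanishing total mass and vanishing vector of inertia. That is, there do not exist non-zero real masses $m_1,m_2,m_3,m_4$ with $m_1+m_2+m_3+m_4=0$ and four pairwise distinct points $\vec r_1,\vec r_2,\vec r_3,\vec r_4$ lying on a common circle such that $(\vec r_1,\dots,\vec r_4)$ is a central configuration for these masses (with some multiplier $\xi\in\mathbb{R}$) and $\vec\lambda=\vec 0$.
   Context: For $N$ point bodies with non-zero real masses $m_1,\dots,m_N$ (positive or negative) at pairwise distinct positions $\vec r_1,\dots,\vec r_N$ in a Euclidean vector space, define the accelerations $$\vec\gamma_i=\sum_{j\ne i} m_j\frac{\vec r_j-\vec r_i}{\|\vec r_j-\vec r_i\|^3}.$$ The configuration is called central with multiplier $\xi\in\mathbb{R}$ if $\vec\gamma_j-\vec\gamma_i=\xi(\vec r_j-\vec r_i)$ for all $i,j$. When the total mass $m_1+\dots+m_N$ vanishes, the vector of inertia is $\vec\lambda=\sum_{i=1}^N m_i(\vec r_i-\vec a)$, which does not depend on the origin $\vec a$. A configuration is co-circular if all its points lie on one circle. *)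

theory Defs
  imports "HOL-Analysis.Analysis"
begin

text \<open>Bodies are indexed by the set \<open>{1..N}\<close>; values of the masses and positions at other
  indices are irrelevant. The masses are non-zero and the positions pairwise distinct wherever
  these notions are used.\<close>

definition acceleration ::
  "nat \<Rightarrow> (nat \<Rightarrow> real) \<Rightarrow> (nat \<Rightarrow> 'a::euclidean_space) \<Rightarrow> nat \<Rightarrow> 'a" where
  "acceleration N m r i =
     (\<Sum>j\<in>{1..N} - {i}. m j *\<^sub>R ((r j - r i) /\<^sub>R norm (r j - r i) ^ 3))"

definition central_configuration ::
  "nat \<Rightarrow> (nat \<Rightarrow> real) \<Rightarrow> (nat \<Rightarrow> 'a::euclidean_space) \<Rightarrow> real \<Rightarrow> bool" where
  "central_configuration N m r \<xi> \<longleftrightarrow>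
     (\<forall>i\<in>{1..N}. \<forall>j\<in>{1..N}.
        acceleration N m r j - acceleration N m r i = \<xi> *\<^sub>R (r j - r i))"

definition total_mass :: "nat \<Rightarrow> (nat \<Rightarrow> real) \<Rightarrow> real" where
  "total_mass N m = (\<Sum>i\<in>{1..N}. m i)"

text \<open>The last argument is the origin; it is immaterial if the total mass vanishes, see
  \<open>inertia_vector_origin\<close>.\<close>

definition inertia_vector ::
  "nat \<Rightarrow> (nat \<Rightarrow> real) \<Rightarrow> (nat \<Rightarrow> 'a::euclidean_space) \<Rightarrow> 'a \<Rightarrow> 'a" where
  "inertia_vector N m r a = (\<Sum>i\<in>{1..N}. m i *\<^sub>R (r i - a))"

lemma inertia_vector_origin:
  assumes "total_mass N m = 0"
  shows "inertia_vector N m r a = inertia_vector N m r b"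
proof -
  have "inertia_vector N m r c = (\<Sum>i\<in>{1..N}. m i *\<^sub>R r i)" for c
    using assms
    by (simp add: inertia_vector_def total_mass_def scaleR_diff_right sum_subtractf
        flip: scaleR_sum_left)
  then show ?thesis by simp
qed

text \<open>In a space of dimension greater than two, a sphere must be cut by an affine plane through
  its centre to give a circle.\<close>

definition circle :: "'a::euclidean_space set \<Rightarrow> bool" where
  "circle C \<longleftrightarrow>
     (\<exists>P c \<rho>. affine P \<and> aff_dim P = 2 \<and> c \<in> P \<and> \<rho> > 0 \<and> C = P \<inter> sphere c \<rho>)"

definition co_circular :: "nat \<Rightarrow> (nat \<Rightarrow> 'a::euclidean_space) \<Rightarrow> bool" where
  "co_circular N r \<longleftrightarrow> (\<exists>C. circle C \<and> r ` {1..N} \<subseteq> C)"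

end

theory Submission
  imports Defs
begin

text \<open>
  The circle lies on a sphere, and on a sphere the equations of a central configuration force the
  Newtonian potential \<open>\<Sum>\<^sub>i\<^sub><\<^sub>j m\<^sub>i m\<^sub>j / r\<^sub>i\<^sub>j\<close> to vanish (lemma \<open>potential_eq_0\<close>). Indeed \<open>\<gamma>\<^sub>i\<close> is an
  affine function of \<open>r\<^sub>i\<close>. Its inner product with the radius vector of body \<open>i\<close> is
  \<open>- 1/2 \<Sum>\<^sub>j m\<^sub>j / r\<^sub>i\<^sub>j\<close> on the one hand, and an affine function of \<open>r\<^sub>i\<close> on the other, since that
  radius vector has constant length. Affine functions have weighted sum zero when the total mass
  and the vector of inertia vanish.

  It remains to see that the potential of four such bodies is negative (lemma \<open>potential_neg\<close>). On
  a sphere, the squared distance to a fixed body is again affine in the position, so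
  \<open>w\<^sub>i\<^sub>j = m\<^sub>i m\<^sub>j r\<^sub>i\<^sub>j\<^sup>2\<close> defines a symmetric \<open>4 \<times> 4\<close> matrix with zero diagonal and zero row sums. The
  row sums show that no three masses have the same sign; number the bodies so that 1, 3 have one
  sign and 2, 4 the other. A matrix of this kind is given by three numbers with sum zero:
  \<open>w\<^sub>1\<^sub>2 = w\<^sub>3\<^sub>4\<close>, \<open>w\<^sub>1\<^sub>3 = w\<^sub>2\<^sub>4\<close>, \<open>w\<^sub>1\<^sub>4 = w\<^sub>2\<^sub>3\<close> (lemma \<open>zero_row_sums\<close>). With \<open>A = - w\<^sub>1\<^sub>2 > 0\<close> and
  \<open>B = - w\<^sub>1\<^sub>4 > 0\<close> the potential is
  \<open>(A + B)(r\<^sub>1\<^sub>3\<^sup>-\<^sup>3 + r\<^sub>2\<^sub>4\<^sup>-\<^sup>3) - A (r\<^sub>1\<^sub>2\<^sup>-\<^sup>3 + r\<^sub>3\<^sub>4\<^sup>-\<^sup>3) - B (r\<^sub>2\<^sub>3\<^sup>-\<^sup>3 + r\<^sub>1\<^sub>4\<^sup>-\<^sup>3)\<close>.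
  It is thus enough that each pair of opposite sides has a larger sum of inverse cubes than the
  pair of diagonals. This follows from two facts of classical geometry, which here come out of the
  row sums: the product of two opposite sides is less than that of the diagonals (Ptolemy), and,
  opposite angles being supplementary, each diagonal is longer than both sides on at least one of
  its two flanks.
\<close>

section \<open>Configurations on a sphere\<close>

text \<open>The squared distance \<open>\<parallel>x - y\<parallel>\<^sup>2\<close> is affine in \<open>x\<close> as long as \<open>x\<close> and \<open>y\<close> stay on the sphere.\<close>

lemma sum_mass_squared_distance_eq_0:
  fixes r :: "nat \<Rightarrow> 'a::euclidean_space"
  assumes mass: "total_mass N m = 0" and inertia: "inertia_vector N m r a = 0"
    and sphere: "\<And>i. i \<in> {1..N} \<Longrightarrow> norm (r i - c) = \<rho>" and i: "i \<in> {1..N}"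
  shows "(\<Sum>j\<in>{1..N}. m j * (norm (r j - r i))\<^sup>2) = 0"
proof -
  have inertia_c: "(\<Sum>j\<in>{1..N}. m j *\<^sub>R (r j - c)) = 0"
    using inertia_vector_origin[OF mass, of r a c] inertia by (simp add: inertia_vector_def)
  have dist: "(norm (r j - r i))\<^sup>2 = 2 * \<rho>\<^sup>2 - 2 * ((r j - c) \<bullet> (r i - c))"
    if "j \<in> {1..N}" for j
  proof -
    have "(norm (r j - r i))\<^sup>2 = (norm ((r j - c) - (r i - c)))\<^sup>2"
      by simp
    also have "\<dots> = (norm (r j - c))\<^sup>2 + (norm (r i - c))\<^sup>2 - 2 * ((r j - c) \<bullet> (r i - c))"
      unfolding power2_norm_eq_inner by (simp only: inner_diff_left inner_diff_right inner_commute)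
        (simp add: inner_commute)
    finally show ?thesis
      using sphere[OF that] sphere[OF i] by simp
  qed
  have "(\<Sum>j\<in>{1..N}. m j * (norm (r j - r i))\<^sup>2)
      = (\<Sum>j\<in>{1..N}. m j * (2 * \<rho>\<^sup>2) - 2 * ((m j *\<^sub>R (r j - c)) \<bullet> (r i - c)))"
    by (rule sum.cong) (simp_all add: dist algebra_simps)
  also have "\<dots> = total_mass N m * (2 * \<rho>\<^sup>2)
      - 2 * ((\<Sum>j\<in>{1..N}. m j *\<^sub>R (r j - c)) \<bullet> (r i - c))"
    by (simp only: sum_subtractf total_mass_def sum_distrib_right sum_distrib_left inner_sum_left)
  finally show ?thesis
    using mass inertia_c by simp
qed

text \<open>On a sphere, the radial component of the force turns the inverse cube of a distance into its
  inverse, because \<open>(x - y) \<bullet> (y - c) = - \<parallel>x - y\<parallel>\<^sup>2 / 2\<close>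
  for points \<open>x, y\<close> of a sphere with centre \<open>c\<close>.\<close>

lemma acceleration_inner_radius:
  fixes r :: "nat \<Rightarrow> 'a::euclidean_space"
  assumes sphere: "\<And>i. i \<in> {1..N} \<Longrightarrow> norm (r i - c) = \<rho>" and i: "i \<in> {1..N}"
  shows "acceleration N m r i \<bullet> (r i - c)
    = - (\<Sum>j\<in>{1..N} - {i}. m j / norm (r j - r i)) / 2"
proof -
  have summand: "(m j *\<^sub>R ((r j - r i) /\<^sub>R norm (r j - r i) ^ 3)) \<bullet> (r i - c)
      = - (m j / norm (r j - r i)) / 2"
    if "j \<in> {1..N}" for j
  proof -
    let ?n = "norm (r j - r i)"
    have "(norm (r j - c))\<^sup>2 = (norm ((r j - r i) + (r i - c)))\<^sup>2"
      by simp
    also have "\<dots> = ?n\<^sup>2 + 2 * ((r j - r i) \<bullet> (r i - c)) + (norm (r i - c))\<^sup>2"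
      unfolding power2_norm_eq_inner by (simp only: inner_add_left inner_add_right)
        (simp add: inner_commute)
    finally have radial: "(r j - r i) \<bullet> (r i - c) = - ?n\<^sup>2 / 2"
      using sphere[OF that] sphere[OF i] by simp
    show ?thesis
      unfolding inner_scaleR_left radial
      by (cases "?n = 0") (simp_all add: field_simps power2_eq_square power3_eq_cube)
  qed
  have "acceleration N m r i \<bullet> (r i - c)
      = (\<Sum>j\<in>{1..N} - {i}. - (m j / norm (r j - r i)) / 2)"
    unfolding acceleration_def inner_sum_left by (rule sum.cong) (simp_all only: summand DiffD1)
  then show ?thesis
    by (simp add: sum_negf sum_divide_distrib)
qed

lemma potential_eq_0:
  fixes r :: "nat \<Rightarrow> 'a::euclidean_space"
  assumes mass: "total_mass N m = 0" and inertia: "inertia_vector N m r a = 0"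
    and central: "central_configuration N m r \<xi>"
    and sphere: "\<And>i. i \<in> {1..N} \<Longrightarrow> norm (r i - c) = \<rho>"
  shows "(\<Sum>i\<in>{1..N}. m i * (\<Sum>j\<in>{1..N} - {i}. m j / norm (r j - r i))) = 0"
proof (cases "N = 0")
  case False
  have inertia_c: "(\<Sum>j\<in>{1..N}. m j *\<^sub>R (r j - c)) = 0"
    using inertia_vector_origin[OF mass, of r a c] inertia by (simp add: inertia_vector_def)
  define k where "k = acceleration N m r 1 - \<xi> *\<^sub>R (r 1 - c)"
  have acc: "acceleration N m r i = \<xi> *\<^sub>R (r i - c) + k" if "i \<in> {1..N}" for i
  proof -
    have "acceleration N m r i - acceleration N m r 1 = \<xi> *\<^sub>R (r i - r 1)"
      using central that False unfolding central_configuration_def by auto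
    then show ?thesis
      by (simp add: k_def algebra_simps)
  qed
  have radial: "(\<Sum>j\<in>{1..N} - {i}. m j / norm (r j - r i))
      = - 2 * (\<xi> * \<rho>\<^sup>2 + k \<bullet> (r i - c))" if i: "i \<in> {1..N}" for i
  proof -
    have "acceleration N m r i \<bullet> (r i - c) = \<xi> * ((r i - c) \<bullet> (r i - c)) + k \<bullet> (r i - c)"
      unfolding acc[OF i] by (simp only: inner_add_left inner_scaleR_left)
    also have "(r i - c) \<bullet> (r i - c) = \<rho>\<^sup>2"
      using sphere[OF i] by (simp flip: power2_norm_eq_inner)
    finally show ?thesis
      using acceleration_inner_radius[of N r c \<rho> i m, OF sphere i] by simp
  qed
  have "(\<Sum>i\<in>{1..N}. m i * (\<Sum>j\<in>{1..N} - {i}. m j / norm (r j - r i)))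
      = (\<Sum>i\<in>{1..N}. m i * (- 2 * \<xi> * \<rho>\<^sup>2) - 2 * (k \<bullet> (m i *\<^sub>R (r i - c))))"
    by (rule sum.cong[OF refl], simp only: radial inner_scaleR_right) (simp add: algebra_simps)
  also have "\<dots> = total_mass N m * (- 2 * \<xi> * \<rho>\<^sup>2)
      - 2 * (k \<bullet> (\<Sum>i\<in>{1..N}. m i *\<^sub>R (r i - c)))"
    by (simp only: sum_subtractf total_mass_def sum_distrib_right sum_distrib_left inner_sum_right)
  finally show ?thesis
    using mass inertia_c by simp
qed simp

section \<open>The potential of four bodies\<close>

lemma zero_row_sums:
  fixes w12 w13 w14 w23 w24 w34 :: real
  assumes "w12 + w13 + w14 = 0" "w12 + w23 + w24 = 0" "w13 + w23 + w34 = 0" "w14 + w24 + w34 = 0"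
  shows "w34 = w12" "w24 = w13" "w23 = w14"
  using assms by linarith+

text \<open>The factor \<open>1/x\<^sup>3\<close> is convex and decreasing as a function of \<open>ln x\<close>, so this is an instance of
  weak majorization. With \<open>u, v, p, q\<close> the inverse cubes of \<open>x, y, e, f\<close>, it comes down to
  \<open>(u - p) (u - q) \<ge> 0\<close>, which gives \<open>u + v > u + p q / u \<ge> p + q\<close>.\<close>

lemma inverse_cubes_less:
  fixes x y e f :: real
  assumes pos: "0 < x" "0 < y" "0 < e" "0 < f"
    and le: "x \<le> e" "x \<le> f" and prod: "x * y < e * f"
  shows "1 / e ^ 3 + 1 / f ^ 3 < 1 / x ^ 3 + 1 / y ^ 3"
proof -
  define u v p q where uvpq: "u = 1 / x ^ 3" "v = 1 / y ^ 3" "p = 1 / e ^ 3" "q = 1 / f ^ 3"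
  have u: "0 < u"
    using pos by (simp add: uvpq)
  have "p \<le> u" "q \<le> u"
    using pos le by (auto simp: uvpq intro!: divide_left_mono power_mono)
  then have "0 \<le> (u - p) * (u - q)"
    by simp
  moreover have "p * q < u * v"
  proof -
    have "(x * y) ^ 3 < (e * f) ^ 3"
      using pos prod by (intro power_strict_mono) auto
    then have "1 / (e * f) ^ 3 < 1 / (x * y) ^ 3"
      using pos by (intro divide_strict_left_mono) auto
    then show ?thesis
      by (simp add: uvpq power_mult_distrib)
  qed
  ultimately have "u * (p + q) < u * (u + v)"
    by (simp add: algebra_simps)
  then have "p + q < u + v"
    using u by (simp only: mult_less_cancel_left_pos)
  then show ?thesis
    by (simp add: uvpq)
qed

text \<open>Here \<open>a, b, c, d\<close> are the successive sides of a quadrilateral, \<open>e\<close> cuts off \<open>a, b\<close> from \<open>c, d\<close>,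
  and \<open>f\<close> cuts off \<open>a, d\<close> from \<open>b, c\<close>. A flank of \<open>e\<close> and a flank of \<open>f\<close>
  share exactly one side. If both flanks are short, this side is shorter than both diagonals, and
  \<open>inverse_cubes_less\<close> applies to it and the opposite side. Of the other two sides, one is shorter than \<open>e\<close> and the other shorter than \<open>f\<close>.\<close>

lemma opposite_sides_inverse_cubes_less:
  fixes a b c d e f :: real
  assumes pos: "0 < a" "0 < b" "0 < c" "0 < d" "0 < e" "0 < f"
    and flank_e: "a < e \<and> b < e \<or> c < e \<and> d < e"
    and flank_f: "a < f \<and> d < f \<or> b < f \<and> c < f"
    and ptolemy: "a * c < e * f" "b * d < e * f"
  shows "1 / e ^ 3 + 1 / f ^ 3 < 1 / a ^ 3 + 1 / c ^ 3"
    and "1 / e ^ 3 + 1 / f ^ 3 < 1 / b ^ 3 + 1 / d ^ 3"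
proof -
  have cube: "1 / y ^ 3 < 1 / x ^ 3" if "0 < x" "x < y" for x y :: real
    using that by (intro divide_strict_left_mono power_strict_mono) auto
  have crossing: "1 / e ^ 3 + 1 / f ^ 3 < 1 / x ^ 3 + 1 / y ^ 3"
    if "0 < x" "0 < y" "x < e \<and> y < f \<or> x < f \<and> y < e" for x y
    using that cube[of x e] cube[of y f] cube[of x f] cube[of y e] by linarith
  have short: "1 / e ^ 3 + 1 / f ^ 3 < 1 / x ^ 3 + 1 / y ^ 3"
    if "0 < x" "0 < y" "x * y < e * f" "x < e \<and> x < f \<or> y < e \<and> y < f" for x y
    using that inverse_cubes_less[of x y e f] inverse_cubes_less[of y x e f] pos
    by (auto simp: mult.commute add.commute)
  have "a < e \<and> c < f \<or> a < f \<and> c < e \<or> a < e \<and> a < f \<or> c < e \<and> c < f"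
    using flank_e flank_f by blast
  then show "1 / e ^ 3 + 1 / f ^ 3 < 1 / a ^ 3 + 1 / c ^ 3"
    using crossing[of a c] short[of a c] pos ptolemy by blast
  have "b < e \<and> d < f \<or> b < f \<and> d < e \<or> b < e \<and> b < f \<or> d < e \<and> d < f"
    using flank_e flank_f by blast
  then show "1 / e ^ 3 + 1 / f ^ 3 < 1 / b ^ 3 + 1 / d ^ 3"
    using crossing[of b d] short[of b d] pos ptolemy by blast
qed

text \<open>By the law of cosines, the sign of \<open>a\<^sup>2 + b\<^sup>2 - e\<^sup>2\<close> tells whether the angle facing \<open>e\<close> between
  \<open>a\<close> and \<open>b\<close> is acute. Weighted by masses of equal sign at the two vertices facing \<open>e\<close>, these
  excesses cancel, so one of the two angles is not acute.\<close>

lemma diagonal_longer_than_flank: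
  fixes p q a b c d e :: real
  assumes pos: "0 < a" "0 < b" "0 < c" "0 < d" "0 < e" and sign: "0 < p * q"
    and excess: "p * (a\<^sup>2 + b\<^sup>2 - e\<^sup>2) + q * (c\<^sup>2 + d\<^sup>2 - e\<^sup>2) = 0"
  shows "a < e \<and> b < e \<or> c < e \<and> d < e"
proof -
  have less: "x < e" if "0 < y" "x\<^sup>2 + y\<^sup>2 \<le> e\<^sup>2" for x y
  proof (rule power2_less_imp_less)
    show "x\<^sup>2 < e\<^sup>2"
      using that zero_less_power[of y 2] by linarith
  qed (use pos in simp)
  have "\<not> (0 < a\<^sup>2 + b\<^sup>2 - e\<^sup>2 \<and> 0 < c\<^sup>2 + d\<^sup>2 - e\<^sup>2)"
  proof
    assume h: "0 < a\<^sup>2 + b\<^sup>2 - e\<^sup>2 \<and> 0 < c\<^sup>2 + d\<^sup>2 - e\<^sup>2"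
    from sign consider "0 < p" "0 < q" | "p < 0" "q < 0"
      by (auto simp: zero_less_mult_iff)
    then show False
    proof cases
      case 1
      then show False
        using h excess by (smt (verit) mult_pos_pos)
    next
      case 2
      then show False
        using h excess by (smt (verit) mult_neg_pos)
    qed
  qed
  then have "a\<^sup>2 + b\<^sup>2 \<le> e\<^sup>2 \<or> c\<^sup>2 + d\<^sup>2 \<le> e\<^sup>2"
    by linarith
  then show ?thesis
    using less[of b a] less[of a b] less[of d c] less[of c d] pos by (auto simp: add.commute)
qed

text \<open>The hypotheses \<open>row1\<close>, ..., \<open>row4\<close> say that the weighted squared distances to each body sum
  to zero. The bodies 1, 3 are the ends of one diagonal, the bodies 2, 4 those of the other.\<close>

lemma potential_neg_if_same_sign:
  fixes m1 m2 m3 m4 d12 d13 d14 d23 d24 d34 :: real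
  assumes pos: "0 < d12" "0 < d13" "0 < d14" "0 < d23" "0 < d24" "0 < d34"
    and mass: "m1 + m2 + m3 + m4 = 0"
    and row1: "m2 * d12\<^sup>2 + m3 * d13\<^sup>2 + m4 * d14\<^sup>2 = 0"
    and row2: "m1 * d12\<^sup>2 + m3 * d23\<^sup>2 + m4 * d24\<^sup>2 = 0"
    and row3: "m1 * d13\<^sup>2 + m2 * d23\<^sup>2 + m4 * d34\<^sup>2 = 0"
    and row4: "m1 * d14\<^sup>2 + m2 * d24\<^sup>2 + m3 * d34\<^sup>2 = 0"
    and sign: "m1 * m2 < 0" "m1 * m4 < 0"
  shows "m1 * m2 / d12 + m1 * m3 / d13 + m1 * m4 / d14
       + m2 * m3 / d23 + m2 * m4 / d24 + m3 * m4 / d34 < 0"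
proof -
  define A B where AB: "A = - (m1 * m2 * d12\<^sup>2)" "B = - (m1 * m4 * d14\<^sup>2)"
  have A: "0 < A" and B: "0 < B"
    using pos sign by (simp_all add: AB mult_neg_pos)
  have rows:
    "m1 * m2 * d12\<^sup>2 + m1 * m3 * d13\<^sup>2 + m1 * m4 * d14\<^sup>2 = 0"
    "m1 * m2 * d12\<^sup>2 + m2 * m3 * d23\<^sup>2 + m2 * m4 * d24\<^sup>2 = 0"
    "m1 * m3 * d13\<^sup>2 + m2 * m3 * d23\<^sup>2 + m3 * m4 * d34\<^sup>2 = 0"
    "m1 * m4 * d14\<^sup>2 + m2 * m4 * d24\<^sup>2 + m3 * m4 * d34\<^sup>2 = 0"
    using arg_cong[OF row1, of "\<lambda>x. m1 * x"] arg_cong[OF row2, of "\<lambda>x. m2 * x"]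
      arg_cong[OF row3, of "\<lambda>x. m3 * x"] arg_cong[OF row4, of "\<lambda>x. m4 * x"]
    by (simp_all add: algebra_simps)
  have w: "m1 * m2 * d12\<^sup>2 = - A" "m3 * m4 * d34\<^sup>2 = - A"
    "m1 * m4 * d14\<^sup>2 = - B" "m2 * m3 * d23\<^sup>2 = - B"
    "m1 * m3 * d13\<^sup>2 = A + B" "m2 * m4 * d24\<^sup>2 = A + B"
    using zero_row_sums[OF rows] rows(1) by (simp_all add: AB)
  have m13: "0 < m1 * m3" and m24: "0 < m2 * m4"
    using w(5,6) A B pos by (smt (verit) mult_nonpos_nonneg zero_le_power2)+
  \<comment> \<open>Ptolemy: up to the common factor \<open>m1 m2 m3 m4\<close>, the squared products of opposite edges are
    the squares of \<open>A\<close>, \<open>B\<close> and \<open>A + B\<close>.\<close>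
  have "0 < (m1 * m3) * (m2 * m4)"
    using m13 m24 by simp
  then have P: "0 < m1 * m2 * m3 * m4"
    by (simp add: mult.assoc mult.commute mult.left_commute)
  have eqA: "m1 * m2 * m3 * m4 * (d12 * d34)\<^sup>2 = A\<^sup>2"
  proof -
    have "m1 * m2 * m3 * m4 * (d12 * d34)\<^sup>2 = (m1 * m2 * d12\<^sup>2) * (m3 * m4 * d34\<^sup>2)"
      by (simp add: power_mult_distrib)
    then show ?thesis
      by (simp only: w) (simp add: power2_eq_square)
  qed
  have eqB: "m1 * m2 * m3 * m4 * (d23 * d14)\<^sup>2 = B\<^sup>2"
  proof -
    have "m1 * m2 * m3 * m4 * (d23 * d14)\<^sup>2 = (m1 * m4 * d14\<^sup>2) * (m2 * m3 * d23\<^sup>2)"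
      by (simp add: power_mult_distrib)
    then show ?thesis
      by (simp only: w) (simp add: power2_eq_square)
  qed
  have eqC: "m1 * m2 * m3 * m4 * (d13 * d24)\<^sup>2 = (A + B)\<^sup>2"
  proof -
    have "m1 * m2 * m3 * m4 * (d13 * d24)\<^sup>2 = (m1 * m3 * d13\<^sup>2) * (m2 * m4 * d24\<^sup>2)"
      by (simp add: power_mult_distrib)
    then show ?thesis
      by (simp only: w) (simp add: power2_eq_square)
  qed
  have "A\<^sup>2 < (A + B)\<^sup>2" "B\<^sup>2 < (A + B)\<^sup>2"
    using A B by (auto intro!: power_strict_mono)
  then have "(d12 * d34)\<^sup>2 < (d13 * d24)\<^sup>2" "(d23 * d14)\<^sup>2 < (d13 * d24)\<^sup>2"
    unfolding eqA[symmetric] eqB[symmetric] eqC[symmetric]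
    by (simp_all only: mult_less_cancel_left_pos[OF P])
  then have ptolemy: "d12 * d34 < d13 * d24" "d23 * d14 < d13 * d24"
    using pos by (auto intro: power2_less_imp_less)
  have "m2 * (d12\<^sup>2 + d23\<^sup>2 - d13\<^sup>2) + m4 * (d34\<^sup>2 + d14\<^sup>2 - d13\<^sup>2)
      = (m2 * d12\<^sup>2 + m3 * d13\<^sup>2 + m4 * d14\<^sup>2) + (m1 * d13\<^sup>2 + m2 * d23\<^sup>2 + m4 * d34\<^sup>2)
        - (m1 + m2 + m3 + m4) * d13\<^sup>2"
    by (simp add: algebra_simps)
  then have flank13: "d12 < d13 \<and> d23 < d13 \<or> d34 < d13 \<and> d14 < d13"
    using pos m24 row1 row3 mass by (intro diagonal_longer_than_flank[of _ _ _ _ _ m2 m4]) simp_all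
  have "m1 * (d12\<^sup>2 + d14\<^sup>2 - d24\<^sup>2) + m3 * (d23\<^sup>2 + d34\<^sup>2 - d24\<^sup>2)
      = (m1 * d12\<^sup>2 + m3 * d23\<^sup>2 + m4 * d24\<^sup>2) + (m1 * d14\<^sup>2 + m2 * d24\<^sup>2 + m3 * d34\<^sup>2)
        - (m1 + m2 + m3 + m4) * d24\<^sup>2"
    by (simp add: algebra_simps)
  then have flank24: "d12 < d24 \<and> d14 < d24 \<or> d23 < d24 \<and> d34 < d24"
    using pos m13 row2 row4 mass by (intro diagonal_longer_than_flank[of _ _ _ _ _ m1 m3]) simp_all
  note cubes = opposite_sides_inverse_cubes_less[of d12 d23 d34 d14 d13 d24,
      OF pos(1,4,6,3,2,5) flank13 flank24 ptolemy]
  have divide: "x / y = z * (1 / y ^ 3)" if "x * y\<^sup>2 = z" "0 < y" for x y z :: real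
    using that by (auto simp: field_simps power2_eq_square power3_eq_cube)
  have "m1 * m2 / d12 + m1 * m3 / d13 + m1 * m4 / d14
       + m2 * m3 / d23 + m2 * m4 / d24 + m3 * m4 / d34
     = A * ((1 / d13 ^ 3 + 1 / d24 ^ 3) - (1 / d12 ^ 3 + 1 / d34 ^ 3))
     + B * ((1 / d13 ^ 3 + 1 / d24 ^ 3) - (1 / d23 ^ 3 + 1 / d14 ^ 3))"
    unfolding w(1)[THEN divide, OF pos(1)]
      w(2)[THEN divide, OF pos(6)] w(3)[THEN divide, OF pos(3)] w(4)[THEN divide, OF pos(4)]
      w(5)[THEN divide, OF pos(2)] w(6)[THEN divide, OF pos(5)]
    by (simp add: algebra_simps add_divide_distrib)
  also have "\<dots> < 0"
    using A B cubes by (intro add_neg_neg mult_pos_neg) auto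
  finally show ?thesis .
qed

lemma potential_neg:
  fixes m1 m2 m3 m4 d12 d13 d14 d23 d24 d34 :: real
  assumes pos: "0 < d12" "0 < d13" "0 < d14" "0 < d23" "0 < d24" "0 < d34"
    and nonzero: "m1 \<noteq> 0" "m2 \<noteq> 0" "m3 \<noteq> 0" "m4 \<noteq> 0"
    and mass: "m1 + m2 + m3 + m4 = 0"
    and row1: "m2 * d12\<^sup>2 + m3 * d13\<^sup>2 + m4 * d14\<^sup>2 = 0"
    and row2: "m1 * d12\<^sup>2 + m3 * d23\<^sup>2 + m4 * d24\<^sup>2 = 0"
    and row3: "m1 * d13\<^sup>2 + m2 * d23\<^sup>2 + m4 * d34\<^sup>2 = 0"
    and row4: "m1 * d14\<^sup>2 + m2 * d24\<^sup>2 + m3 * d34\<^sup>2 = 0"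
  shows "m1 * m2 / d12 + m1 * m3 / d13 + m1 * m4 / d14
       + m2 * m3 / d23 + m2 * m4 / d24 + m3 * m4 / d34 < 0"
proof -
  \<comment> \<open>No three masses have the same sign, since the row of the fourth body would then be a sum of
    terms of one sign. Hence exactly one other body has the sign of body 1; in the cases 12 and 14
    it trades places with body 3.\<close>
  have one_sign: False if "0 < x \<and> 0 < y \<and> 0 < z \<or> x < 0 \<and> y < 0 \<and> z < 0"
    "x * p\<^sup>2 + y * q\<^sup>2 + z * s\<^sup>2 = 0" "0 < p" "0 < q" "0 < s" for x y z p q s :: real
  proof -
    have "0 < p\<^sup>2" "0 < q\<^sup>2" "0 < s\<^sup>2"
      using that by simp_all
    with that(1) have "0 < x * p\<^sup>2 \<and> 0 < y * q\<^sup>2 \<and> 0 < z * s\<^sup>2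
        \<or> x * p\<^sup>2 < 0 \<and> y * q\<^sup>2 < 0 \<and> z * s\<^sup>2 < 0"
      by (auto simp: mult_neg_pos)
    then show False
      using that(2) by linarith
  qed
  consider (13) "m1 * m2 < 0" "m1 * m4 < 0" | (12) "m1 * m3 < 0" "m1 * m4 < 0"
    | (14) "m1 * m2 < 0" "m1 * m3 < 0"
    using nonzero one_sign[OF _ row1 pos(1-3)] one_sign[OF _ row2 pos(1,4,5)]
      one_sign[OF _ row3 pos(2,4,6)] one_sign[OF _ row4 pos(3,5,6)]
    unfolding mult_less_0_iff by (smt (verit))
  then show ?thesis
  proof cases
    case 13
    show ?thesis
      by (rule potential_neg_if_same_sign[OF pos mass row1 row2 row3 row4 13])
  next
    case 12
    show ?thesis
      using potential_neg_if_same_sign[of d13 d12 d14 d23 d34 d24 m1 m3 m2 m4]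
        pos mass row1 row2 row3 row4 12 by (simp add: ac_simps)
  next
    case 14
    show ?thesis
      using potential_neg_if_same_sign[of d12 d14 d13 d24 d23 d34 m1 m2 m4 m3]
        pos mass row1 row2 row3 row4 14 by (simp add: ac_simps)
  qed
qed

section \<open>Co-circular configurations of four bodies\<close>

theorem theorem3:
  fixes a :: "'a::euclidean_space"
  shows "\<not> (\<exists>(m :: nat \<Rightarrow> real) (r :: nat \<Rightarrow> 'a) (\<xi> :: real).
           (\<forall>i\<in>{1..4}. m i \<noteq> 0) \<and> total_mass 4 m = 0 \<and>
           inj_on r {1..4} \<and> co_circular 4 r \<and>
           central_configuration 4 m r \<xi> \<and>
           inertia_vector 4 m r a = 0)"
proof
  assume "\<exists>(m :: nat \<Rightarrow> real) (r :: nat \<Rightarrow> 'a) (\<xi> :: real).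
           (\<forall>i\<in>{1..4}. m i \<noteq> 0) \<and> total_mass 4 m = 0 \<and>
           inj_on r {1..4} \<and> co_circular 4 r \<and>
           central_configuration 4 m r \<xi> \<and>
           inertia_vector 4 m r a = 0"
  then obtain m :: "nat \<Rightarrow> real" and r :: "nat \<Rightarrow> 'a" and \<xi> :: real where
    nonzero: "\<forall>i\<in>{1..4}. m i \<noteq> 0" and mass: "total_mass 4 m = 0"
    and inj: "inj_on r {1..4}" and circ: "co_circular 4 r"
    and central: "central_configuration 4 m r \<xi>" and inertia: "inertia_vector 4 m r a = 0"
    by blast
  obtain c \<rho> where on_sphere: "r ` {1..4} \<subseteq> sphere c \<rho>"
    using circ unfolding co_circular_def circle_def by blast
  then have sphere: "norm (r i - c) = \<rho>" if "i \<in> {1..4}" for i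
  proof -
    have "r i \<in> sphere c \<rho>"
      using that on_sphere by blast
    then show ?thesis
      by (simp add: dist_norm norm_minus_commute)
  qed
  have idx: "{1..4} = {1, 2, 3, 4 :: nat}"
    by auto
  define d where "d i j = norm (r i - r j)" for i j
  have d_sym: "d i j = d j i" for i j
    by (simp add: d_def norm_minus_commute)
  have d_pos: "0 < d i j" if "i \<in> {1..4}" "j \<in> {1..4}" "i \<noteq> j" for i j
    using inj that by (auto simp: d_def inj_on_def)
  have row: "(\<Sum>j\<in>{1..4}. m j * (d j i)\<^sup>2) = 0" if "i \<in> {1..4}" for i
    unfolding d_def by (rule sum_mass_squared_distance_eq_0[OF mass inertia sphere that])
  have "(\<Sum>i\<in>{1..4}. m i * (\<Sum>j\<in>{1..4} - {i}. m j / d j i)) = 0"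
    unfolding d_def by (rule potential_eq_0[OF mass inertia central sphere])
  then have "m 1 * (m 2 / d 1 2 + m 3 / d 1 3 + m 4 / d 1 4)
      + m 2 * (m 1 / d 1 2 + m 3 / d 2 3 + m 4 / d 2 4)
      + m 3 * (m 1 / d 1 3 + m 2 / d 2 3 + m 4 / d 3 4)
      + m 4 * (m 1 / d 1 4 + m 2 / d 2 4 + m 3 / d 3 4) = 0"
    by (simp add: idx insert_Diff_if d_sym[of 2 1] d_sym[of 3 1] d_sym[of 4 1] d_sym[of 3 2]
        d_sym[of 4 2] d_sym[of 4 3] add.assoc del: One_nat_def)
  then have potential: "m 1 * m 2 / d 1 2 + m 1 * m 3 / d 1 3 + m 1 * m 4 / d 1 4
      + m 2 * m 3 / d 2 3 + m 2 * m 4 / d 2 4 + m 3 * m 4 / d 3 4 = 0"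
    by (simp add: algebra_simps)
  have "m 1 * m 2 / d 1 2 + m 1 * m 3 / d 1 3 + m 1 * m 4 / d 1 4
      + m 2 * m 3 / d 2 3 + m 2 * m 4 / d 2 4 + m 3 * m 4 / d 3 4 < 0"
  proof (rule potential_neg)
    show "m 1 + m 2 + m 3 + m 4 = 0"
      using mass by (simp add: total_mass_def idx add.assoc del: One_nat_def)
    have d_self: "d i i = 0" for i
      by (simp add: d_def)
    show "m 2 * (d 1 2)\<^sup>2 + m 3 * (d 1 3)\<^sup>2 + m 4 * (d 1 4)\<^sup>2 = 0"
      using row[of 1] by (simp add: idx d_self d_sym[of 2 1] d_sym[of 3 1] d_sym[of 4 1] add.assoc
          del: One_nat_def)
    show "m 1 * (d 1 2)\<^sup>2 + m 3 * (d 2 3)\<^sup>2 + m 4 * (d 2 4)\<^sup>2 = 0"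
      using row[of 2] by (simp add: idx d_self d_sym[of 3 2] d_sym[of 4 2] add.assoc del: One_nat_def)
    show "m 1 * (d 1 3)\<^sup>2 + m 2 * (d 2 3)\<^sup>2 + m 4 * (d 3 4)\<^sup>2 = 0"
      using row[of 3] by (simp add: idx d_self d_sym[of 4 3] add.assoc del: One_nat_def)
    show "m 1 * (d 1 4)\<^sup>2 + m 2 * (d 2 4)\<^sup>2 + m 3 * (d 3 4)\<^sup>2 = 0"
      using row[of 4] by (simp add: idx d_self add.assoc del: One_nat_def)
  qed (use d_pos nonzero in auto)
  with potential show False
    by simp
qed

end
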